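(* Let $p$ be a prime, let $c\geq 1$ be an integer, and let $G$ be a finite powerful $p$-group. Then $$e(M^{(c)}(G))\leq e(G).$$
   Context: For a finite $p$-group $X$, $e(X)$ is the integer defined by $\exp(X)=p^{e(X)}$, where $\exp(X)$ is the exponent of $X$. For a group $X$, $\mho_i(X)$ denotes the subgroup of $X$ generated by all $p^i$-th powers of elements of $X$. A $p$-group $G$ is called powerful if $p$ is odd and $G'\leq \mho_1(G)$, or $p=2$ and $G'\leq \mho_2(G)$, where $G'=[G,G]$. For a group $G$ with a free presentation $G\cong F/R$ ($F$ a free group, $R$ a normal subgroup of $F$), the $c$-nilpotent multiplier of $G$ is the abelian group $$M^{(c)}(G)=\frac{R\cap\gamma_{c+1}(F)}{[R,{}_cF]},$$ where $\gamma_{c+1}(F)$ is the $(c+1)$-st term of the lower central series of $F$ (with $\gamma_1(F)=F$) and $[R,{}_cF]=[R,F,\ldots,F]$ with $F$ occurring $c$ times (left-normed). Up to isomorphism it does not depend on the free presentation chosen. For a finite $p$-group $G$, $M^{(c)}(G)$ is a finite $p$-group. *)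

theory Defs
  imports
    "HOL-Algebra.Generated_Groups"
    "HOL-Computational_Algebra.Primes"
begin

section \<open>Free groups\<close>

text \<open>
  A word is a list of letters; the letter \<open>(True, x)\<close> stands for \<open>x\<close> and \<open>(False, x)\<close> for the
  inverse of \<open>x\<close>. A group is free on \<open>X\<close> if each of its elements is the value of exactly one
  reduced word over \<open>X\<close>. The lemma \<open>free_on_universal\<close> below derives the usual universal property.
\<close>

definition letter_value :: "('a, 'm) monoid_scheme \<Rightarrow> bool \<times> 'a \<Rightarrow> 'a" where
  "letter_value F l = (if fst l then snd l else inv\<^bsub>F\<^esub> (snd l))"

definition word_value :: "('a, 'm) monoid_scheme \<Rightarrow> (bool \<times> 'a) list \<Rightarrow> 'a" where
  "word_value F w = foldr (\<lambda>l g. letter_value F l \<otimes>\<^bsub>F\<^esub> g) w \<one>\<^bsub>F\<^esub>"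

definition reduced_word :: "(bool \<times> 'a) list \<Rightarrow> bool" where
  "reduced_word w \<longleftrightarrow> successively (\<lambda>l l'. \<not> (snd l = snd l' \<and> fst l \<noteq> fst l')) w"

definition free_on :: "('a, 'm) monoid_scheme \<Rightarrow> 'a set \<Rightarrow> bool" where
  "free_on F X \<longleftrightarrow> group F \<and> X \<subseteq> carrier F \<and>
     bij_betw (word_value F) {w. snd ` set w \<subseteq> X \<and> reduced_word w} (carrier F)"

definition free_group :: "('a, 'm) monoid_scheme \<Rightarrow> bool" where
  "free_group F \<longleftrightarrow> (\<exists>X. free_on F X)"

abbreviation map_word :: "('a \<Rightarrow> 'b) \<Rightarrow> (bool \<times> 'a) list \<Rightarrow> (bool \<times> 'b) list" where
  "map_word f \<equiv> map (apsnd f)"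

lemma word_value_Nil [simp]: "word_value F [] = \<one>\<^bsub>F\<^esub>"
  by (simp add: word_value_def)

lemma word_value_Cons [simp]:
  "word_value F (l # w) = letter_value F l \<otimes>\<^bsub>F\<^esub> word_value F w"
  by (simp add: word_value_def)

lemma (in group) letter_value_closed [simp]:
  "snd l \<in> carrier G \<Longrightarrow> letter_value G l \<in> carrier G"
  by (simp add: letter_value_def)

lemma (in group) word_value_closed [simp]:
  "snd ` set w \<subseteq> carrier G \<Longrightarrow> word_value G w \<in> carrier G"
  by (induction w) auto

lemma (in group) word_value_append:
  "\<lbrakk>snd ` set u \<subseteq> carrier G; snd ` set v \<subseteq> carrier G\<rbrakk> \<Longrightarrow>
    word_value G (u @ v) = word_value G u \<otimes> word_value G v"
  by (induction u) (auto simp: m_assoc)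

lemma (in group) word_value_cancel:
  assumes "snd ` set u \<subseteq> carrier G" "snd ` set v \<subseteq> carrier G" "x \<in> carrier G" "b \<noteq> b'"
  shows "word_value G (u @ (b, x) # (b', x) # v) = word_value G (u @ v)"
  using assms by (cases b) (simp_all add: word_value_append letter_value_def flip: m_assoc)

lemma not_reduced_word_split:
  "\<not> reduced_word w \<Longrightarrow> \<exists>u b b' x v. w = u @ (b, x) # (b', x) # v \<and> b \<noteq> b'"
proof (induction w)
  case (Cons l w)
  show ?case
  proof (cases "reduced_word w")
    case True
    with Cons.prems obtain l' v where "w = l' # v" "snd l = snd l'" "fst l \<noteq> fst l'"
      by (cases w) (auto simp: reduced_word_def)
    then have "l # w = [] @ (fst l, snd l) # (fst l', snd l) # v" "fst l \<noteq> fst l'"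
      by (auto simp: prod_eq_iff)
    then show ?thesis
      by blast
  next
    case False
    with Cons.IH show ?thesis
      by (metis append_Cons)
  qed
qed (simp add: reduced_word_def)

lemma reduced_word_exists:
  assumes F: "group F" "X \<subseteq> carrier F" and H: "group H" "f \<in> X \<rightarrow> carrier H"
  shows "snd ` set w \<subseteq> X \<Longrightarrow>
    \<exists>w'. snd ` set w' \<subseteq> X \<and> reduced_word w' \<and> word_value F w' = word_value F w \<and>
      word_value H (map_word f w') = word_value H (map_word f w)"
proof (induction w rule: length_induct)
  case (1 w)
  show ?case
  proof (cases "reduced_word w")
    case False
    then obtain u b b' x v where w: "w = u @ (b, x) # (b', x) # v" and b: "b \<noteq> b'"
      using not_reduced_word_split by blast
    have sub: "snd ` set u \<subseteq> X" "snd ` set v \<subseteq> X" "x \<in> X"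
      using 1 w by auto
    then have subH: "snd ` set (map_word f u) \<subseteq> carrier H" "snd ` set (map_word f v) \<subseteq> carrier H"
      "f x \<in> carrier H"
      using H(2) by fastforce+
    have "word_value F w = word_value F (u @ v)"
      unfolding w using group.word_value_cancel[OF F(1) _ _ _ b] sub F(2) by blast
    moreover have "word_value H (map_word f w) = word_value H (map_word f (u @ v))"
      using group.word_value_cancel[OF H(1) subH b] by (simp add: w)
    moreover have "length (u @ v) < length w" "snd ` set (u @ v) \<subseteq> X"
      using w sub by auto
    ultimately show ?thesis
      using "1.IH" by metis
  qed (use 1 in blast)
qed

lemma hom_word_value:
  assumes F: "group F" "X \<subseteq> carrier F" and H: "group H"
    and h: "h \<in> hom F H" "\<And>x. x \<in> X \<Longrightarrow> h x = f x"
  shows "snd ` set w \<subseteq> X \<Longrightarrow> h (word_value F w) = word_value H (map_word f w)"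
proof (induction w)
  case Nil
  then show ?case
    using hom_one[OF h(1) F(1) H] by simp
next
  case (Cons l w)
  interpret group_hom F H h
    using F H h by (simp add: group_hom_def group_hom_axioms_def)
  have l: "snd l \<in> carrier F" "snd l \<in> X" and w: "snd ` set w \<subseteq> carrier F"
    using Cons.prems F(2) by auto
  then show ?case
    using Cons h(2)[of "snd l"]
    by (simp add: G.word_value_closed letter_value_def)
qed

lemma free_on_universal:
  assumes F: "free_on F X" and H: "group H" and f: "f \<in> X \<rightarrow> carrier H"
  shows "\<exists>h \<in> hom F H. (\<forall>x\<in>X. h x = f x) \<and>
    (\<forall>k \<in> hom F H. (\<forall>x\<in>X. k x = f x) \<longrightarrow> (\<forall>y\<in>carrier F. k y = h y))"
proof -
  let ?W = "{w. snd ` set w \<subseteq> X \<and> reduced_word w}"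
  have grp: "group F" and X: "X \<subseteq> carrier F" and bij: "bij_betw (word_value F) ?W (carrier F)"
    using F by (auto simp: free_on_def)
  define r where "r = inv_into ?W (word_value F)"
  have r: "snd ` set (r y) \<subseteq> X" "word_value F (r y) = y" if "y \<in> carrier F" for y
    using bij_betw_inv_into_right[OF bij that] bij_betw_apply[OF bij_betw_inv_into[OF bij] that]
    by (auto simp: r_def)
  have r_unique: "r (word_value F w) = w" if "w \<in> ?W" for w
    using bij_betw_inv_into_left[OF bij that] by (simp add: r_def)
  define h where "h y = word_value H (map_word f (r y))" for y
  have h_val: "h (word_value F w) = word_value H (map_word f w)" if w: "snd ` set w \<subseteq> X" for w
    using reduced_word_exists[OF grp X H f w] r_unique by (force simp: h_def)
  have inH: "snd ` set (map_word f w) \<subseteq> carrier H" if "snd ` set w \<subseteq> X" for w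
    using that f by fastforce
  have "h (y \<otimes>\<^bsub>F\<^esub> z) = h y \<otimes>\<^bsub>H\<^esub> h z" if y: "y \<in> carrier F" and z: "z \<in> carrier F" for y z
  proof -
    have "y \<otimes>\<^bsub>F\<^esub> z = word_value F (r y @ r z)"
      using group.word_value_append[OF grp, of "r y" "r z"] r[OF y] r[OF z] X by auto
    then have "h (y \<otimes>\<^bsub>F\<^esub> z) = word_value H (map_word f (r y @ r z))"
      using h_val[of "r y @ r z"] r[OF y] r[OF z] by auto
    also have "\<dots> = h y \<otimes>\<^bsub>H\<^esub> h z"
      using group.word_value_append[OF H inH inH, of "r y" "r z"] r[OF y] r[OF z]
      by (simp add: h_def)
    finally show ?thesis .
  qed
  then have hom: "h \<in> hom F H"
    using group.word_value_closed[OF H inH] r(1) by (auto simp: hom_def h_def)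
  have "h x = f x" if x: "x \<in> X" for x
  proof -
    have "x \<in> carrier F" "f x \<in> carrier H"
      using X f x by auto
    then show ?thesis
      using h_val[of "[(True, x)]"] x grp H
      by (simp add: letter_value_def group.is_monoid)
  qed
  moreover have "k y = h y" if k: "k \<in> hom F H" "\<forall>x\<in>X. k x = f x" and y: "y \<in> carrier F" for k y
    using hom_word_value[OF grp X H k(1), of f "r y"] k(2) r[OF y] by (auto simp: h_def)
  ultimately show ?thesis
    using hom by blast
qed


section \<open>Commutator subgroups and the nilpotent multiplier\<close>

text \<open>The commutator convention agrees with that of \<^const>\<open>derived\<close>.\<close>

definition commutator_subgroup :: "('a, 'm) monoid_scheme \<Rightarrow> 'a set \<Rightarrow> 'a set \<Rightarrow> 'a set" where
  "commutator_subgroup G H K = generate G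
     (\<Union>h\<in>H. \<Union>k\<in>K. {h \<otimes>\<^bsub>G\<^esub> k \<otimes>\<^bsub>G\<^esub> inv\<^bsub>G\<^esub> h \<otimes>\<^bsub>G\<^esub> inv\<^bsub>G\<^esub> k})"

lemma derived_eq_commutator_subgroup: "derived G H = commutator_subgroup G H H"
  by (simp add: derived_def commutator_subgroup_def)

text \<open>\<open>iterated_commutator F R c\<close> is $[R, {}_c F] = [\ldots[[R, F], F], \ldots, F]$ with $c$ copies of $F$.\<close>

primrec iterated_commutator :: "('a, 'm) monoid_scheme \<Rightarrow> 'a set \<Rightarrow> nat \<Rightarrow> 'a set" where
  "iterated_commutator F R 0 = R"
| "iterated_commutator F R (Suc c) =
     commutator_subgroup F (iterated_commutator F R c) (carrier F)"

text \<open>Indexed from \<open>1\<close>, so that \<open>lower_central F 1 = carrier F\<close>; the value at \<open>0\<close> is a dummy.\<close>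

definition lower_central :: "('a, 'm) monoid_scheme \<Rightarrow> nat \<Rightarrow> 'a set" where
  "lower_central F n = iterated_commutator F (carrier F) (n - 1)"

lemma lower_central_simps:
  "lower_central F 1 = carrier F"
  "lower_central F (Suc (Suc n)) = commutator_subgroup F (lower_central F (Suc n)) (carrier F)"
  by (simp_all add: lower_central_def)

definition nilpotent_multiplier :: "nat \<Rightarrow> ('a, 'm) monoid_scheme \<Rightarrow> 'a set \<Rightarrow> 'a set monoid" where
  "nilpotent_multiplier c F R =
     (F\<lparr>carrier := R \<inter> lower_central F (c + 1)\<rparr>) Mod (iterated_commutator F R c)"


section \<open>Exponents and powerful groups\<close>

text \<open>Only meaningful if some positive power annihilates the group, e.g. for finite groups.\<close>

definition group_exponent :: "('a, 'm) monoid_scheme \<Rightarrow> nat" where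
  "group_exponent G = (LEAST n. 0 < n \<and> (\<forall>x\<in>carrier G. x [^]\<^bsub>G\<^esub> n = \<one>\<^bsub>G\<^esub>))"

definition log_exponent :: "nat \<Rightarrow> ('a, 'm) monoid_scheme \<Rightarrow> nat" where
  "log_exponent p G = (THE e. group_exponent G = p ^ e)"

definition mho :: "nat \<Rightarrow> nat \<Rightarrow> ('a, 'm) monoid_scheme \<Rightarrow> 'a set" where
  "mho p i G = generate G {x [^]\<^bsub>G\<^esub> (p ^ i) | x. x \<in> carrier G}"

definition finite_p_group :: "nat \<Rightarrow> ('a, 'm) monoid_scheme \<Rightarrow> bool" where
  "finite_p_group p G \<longleftrightarrow> group G \<and> finite (carrier G) \<and> (\<exists>n. order G = p ^ n)"

definition powerful :: "nat \<Rightarrow> ('a, 'm) monoid_scheme \<Rightarrow> bool" where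
  "powerful p G \<longleftrightarrow>
     odd p \<and> derived G (carrier G) \<subseteq> mho p 1 G \<or>
     p = 2 \<and> derived G (carrier G) \<subseteq> mho p 2 G"

end

theory Submission
  imports Defs "HOL-Algebra.Group_Action" "HOL-Algebra.Multiplicative_Group"
begin

text \<open>
  Write $F = E_0, E_1, \dots, E_e = R$ for a chain of normal subgroups of \<open>F\<close> such that $[E_i,F]$ and
  the \<open>p\<close>-th powers of elements of $E_i$ lie in $E_{i+1}$. The key observation is that this property of a
  pair $(E_i,E_{i+1})$ is inherited by $([E_i,F],[E_{i+1},F])$: as $[E_i,F]$ lies in $E_{i+1}$, it is
  central modulo $[E_{i+1},F]$, so $[x,f]^p \equiv [x^p,f] \equiv 1$ there
  (\<open>commutator_subgroup_central_layer\<close>). Iterating, the subgroups $[E_i,{}_cF]$ again form such a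
  chain, now from $\gamma_{c+1}(F)$ to $[R,{}_cF]$. Each of its \<open>e\<close> steps costs one \<open>p\<close>-th power, so
  the $p^e$-th power of every element of $\gamma_{c+1}(F)$ lies in $[R,{}_cF]$, which bounds the
  exponent of the multiplier by $p^e$.

  It remains to find such a chain of length $e = e(G)$. Its image in \<open>G\<close> should be the lower
  exponent-\<open>p\<close> central series $D_0 = G$, $D_{i+1} = [D_i,G] D_i^p$. For an arbitrary \<open>p\<close>-group this
  series may be much longer than \<open>e(G)\<close>, but in a powerful one the commutators contribute nothing
  new: modulo $D_{i+2}$, the \<open>p\<close>-th power map is a homomorphism on $D_i$ (\<open>powerful_pow_mult\<close>), and its
  image generates $D_{i+1}$ (\<open>powerful_lower_p_series_Suc_subset\<close>). So $D_i$ is generated modulo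
  $D_{i+1}$ by $p^i$-th powers of elements of \<open>G\<close>. For $i = e$ these are trivial, whence
  $D_e = D_{e+1}$; and since a nontrivial finite \<open>p\<close>-group has a nontrivial centre, the series can
  only become stationary at the trivial subgroup (\<open>powerful_lower_p_series_trivial\<close>).
\<close>

section \<open>Commutators, the centre and two collection formulas\<close>

definition commutator :: "('a, 'm) monoid_scheme \<Rightarrow> 'a \<Rightarrow> 'a \<Rightarrow> 'a" where
  "commutator G x y = x \<otimes>\<^bsub>G\<^esub> y \<otimes>\<^bsub>G\<^esub> inv\<^bsub>G\<^esub> x \<otimes>\<^bsub>G\<^esub> inv\<^bsub>G\<^esub> y"

definition group_center :: "('a, 'm) monoid_scheme \<Rightarrow> 'a set" where
  "group_center G = {z \<in> carrier G. \<forall>g\<in>carrier G. z \<otimes>\<^bsub>G\<^esub> g = g \<otimes>\<^bsub>G\<^esub> z}"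

lemma commutator_subgroup_eq:
  "commutator_subgroup G H K = generate G {commutator G h k | h k. h \<in> H \<and> k \<in> K}"
  unfolding commutator_subgroup_def commutator_def by (rule arg_cong[of _ _ "generate G"]) blast

lemma group_centerD:
  "z \<in> group_center G \<Longrightarrow> g \<in> carrier G \<Longrightarrow> z \<otimes>\<^bsub>G\<^esub> g = g \<otimes>\<^bsub>G\<^esub> z"
  by (simp add: group_center_def)

context group
begin

lemma commutator_closed [simp]:
  "x \<in> carrier G \<Longrightarrow> y \<in> carrier G \<Longrightarrow> commutator G x y \<in> carrier G"
  by (simp add: commutator_def)

lemma mult_eq_commutator_mult:
  "x \<in> carrier G \<Longrightarrow> y \<in> carrier G \<Longrightarrow> x \<otimes> y = commutator G x y \<otimes> (y \<otimes> x)"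
  by (simp add: commutator_def m_assoc flip: m_assoc[of "inv y" y])

lemma commutator_eq_one_iff:
  "x \<in> carrier G \<Longrightarrow> y \<in> carrier G \<Longrightarrow> commutator G x y = \<one> \<longleftrightarrow> x \<otimes> y = y \<otimes> x"
  by (metis commutator_closed l_one m_closed mult_eq_commutator_mult one_closed right_cancel)

lemma subgroup_group_center: "subgroup (group_center G) G"
proof (rule subgroupI)
  fix x assume "x \<in> group_center G"
  then have x: "x \<in> carrier G" and comm: "\<And>g. g \<in> carrier G \<Longrightarrow> x \<otimes> g = g \<otimes> x"
    by (auto simp: group_center_def)
  have "inv x \<otimes> g = g \<otimes> inv x" if g: "g \<in> carrier G" for g
  proof -
    have "x \<otimes> (inv x \<otimes> g) = x \<otimes> (g \<otimes> inv x)"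
      using x g comm[of "g \<otimes> inv x"] by (simp add: m_assoc flip: m_assoc[of x "inv x"])
    then show ?thesis
      using x g by simp
  qed
  then show "inv x \<in> group_center G"
    using x by (simp add: group_center_def)
next
  fix x y assume xy: "x \<in> group_center G" "y \<in> group_center G"
  then have c: "x \<in> carrier G" "y \<in> carrier G"
    by (auto simp: group_center_def)
  have "x \<otimes> y \<otimes> g = g \<otimes> (x \<otimes> y)" if g: "g \<in> carrier G" for g
  proof -
    have xg: "x \<otimes> g = g \<otimes> x" and yg: "y \<otimes> g = g \<otimes> y"
      using xy g by (auto simp: group_center_def)
    have "x \<otimes> y \<otimes> g = x \<otimes> g \<otimes> y"
      using m_assoc[of x y g] m_assoc[of x g y] c g yg by simp
    then show ?thesis
      using m_assoc[of g x y] c g xg by simp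
  qed
  then show "x \<otimes> y \<in> group_center G"
    using c by (simp add: group_center_def)
qed (auto simp: group_center_def)

lemma group_center_pow: "z \<in> group_center G \<Longrightarrow> z [^] (n::nat) \<in> group_center G"
  by (induction n)
    (auto intro: subgroup.one_closed[OF subgroup_group_center] subgroup.m_closed[OF subgroup_group_center])

lemma pow_mult_swap:
  assumes "x \<in> carrier G" "y \<in> carrier G" "v \<in> group_center G" "y \<otimes> x = v \<otimes> (x \<otimes> y)"
  shows "y [^] (n::nat) \<otimes> x = v [^] n \<otimes> (x \<otimes> y [^] n)"
proof (induction n)
  case (Suc n)
  have v: "v \<in> carrier G" "\<And>g. g \<in> carrier G \<Longrightarrow> g \<otimes> v = v \<otimes> g"
    using assms(3) by (auto simp: group_center_def)
  have "y [^] Suc n \<otimes> x = (y [^] n \<otimes> v) \<otimes> (x \<otimes> y)"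
    using assms v(1) by (simp add: m_assoc)
  also have "\<dots> = v \<otimes> (y [^] n \<otimes> x) \<otimes> y"
    unfolding v(2)[OF nat_pow_closed[OF assms(2)]] using assms v(1) by (simp add: m_assoc)
  also have "\<dots> = v [^] Suc n \<otimes> (x \<otimes> y [^] Suc n)"
    unfolding Suc using assms v nat_pow_Suc2[of v n] by (simp add: m_assoc)
  finally show ?case .
qed (use assms in auto)

text \<open>
  Moving \<open>g\<close> past \<open>x\<close> produces one copy of the commutator \<open>u\<close>, and moving \<open>x\<close> leftwards past the
  copies of \<open>u\<close> collected so far produces the central element \<open>w\<close> once per pair of factors \<open>x\<close>.
\<close>

lemma pow_conj_two_step:
  assumes "x \<in> carrier G" "u \<in> carrier G" "g \<in> carrier G" "w \<in> group_center G"
    and "g \<otimes> x = x \<otimes> (u \<otimes> g)" "u \<otimes> x = w \<otimes> (x \<otimes> u)"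
  shows "g \<otimes> x [^] (n::nat) = w [^] (n choose 2) \<otimes> (x [^] n \<otimes> (u [^] n \<otimes> g))"
proof (induction n)
  case (Suc n)
  let ?lhs = "g \<otimes> x [^] Suc n" and ?rhs = "x [^] Suc n \<otimes> (u [^] Suc n \<otimes> g)"
  have w: "w \<in> carrier G" "w [^] n \<in> carrier G"
    "\<And>a. a \<in> carrier G \<Longrightarrow> a \<otimes> w [^] n = w [^] n \<otimes> a"
    using assms(4) group_center_pow[OF assms(4), of n] by (simp_all add: group_center_def)
  have "g \<otimes> x [^] Suc n = (g \<otimes> x [^] n) \<otimes> x"
    using assms by (simp add: m_assoc)
  also have "\<dots> = w [^] (n choose 2) \<otimes> (x [^] n \<otimes> ((u [^] n \<otimes> x) \<otimes> (u \<otimes> g)))"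
    unfolding Suc using assms w by (simp add: m_assoc)
  also have "u [^] n \<otimes> x = w [^] n \<otimes> (x \<otimes> u [^] n)"
    using pow_mult_swap assms by blast
  also have "x [^] n \<otimes> (w [^] n \<otimes> (x \<otimes> u [^] n) \<otimes> (u \<otimes> g))
      = w [^] n \<otimes> (x [^] n \<otimes> ((x \<otimes> u [^] n) \<otimes> (u \<otimes> g)))"
    using assms w(1,2) w(3)[of "x [^] n"] by (simp flip: m_assoc)
  finally have *: "?lhs = w [^] (n choose 2) \<otimes> w [^] n \<otimes> ?rhs"
    using assms w(1) by (simp add: m_assoc)
  have "w [^] (n choose 2) \<otimes> w [^] n = w [^] (Suc n choose 2)"
    using w by (simp add: nat_pow_mult numeral_2_eq_2 add.commute)
  with * show ?case by simp
qed (use assms in \<open>auto simp: numeral_2_eq_2\<close>)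

lemma pow_mult_class_two:
  assumes "x \<in> carrier G" "y \<in> carrier G" "v \<in> group_center G" "y \<otimes> x = v \<otimes> (x \<otimes> y)"
  shows "(x \<otimes> y) [^] (n::nat) = v [^] (n choose 2) \<otimes> (x [^] n \<otimes> y [^] n)"
proof (induction n)
  case (Suc n)
  let ?lhs = "(x \<otimes> y) [^] Suc n" and ?rhs = "x [^] Suc n \<otimes> y [^] Suc n"
  have v: "v \<in> carrier G" "v [^] n \<in> carrier G"
    "\<And>a. a \<in> carrier G \<Longrightarrow> a \<otimes> v [^] n = v [^] n \<otimes> a"
    using assms(3) group_center_pow[OF assms(3), of n] by (simp_all add: group_center_def)
  have "(x \<otimes> y) [^] Suc n = v [^] (n choose 2) \<otimes> (x [^] n \<otimes> ((y [^] n \<otimes> x) \<otimes> y))"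
    using assms v Suc by (simp add: m_assoc)
  also have "y [^] n \<otimes> x = v [^] n \<otimes> (x \<otimes> y [^] n)"
    using pow_mult_swap assms by blast
  also have "x [^] n \<otimes> (v [^] n \<otimes> (x \<otimes> y [^] n) \<otimes> y) = v [^] n \<otimes> (x [^] n \<otimes> ((x \<otimes> y [^] n) \<otimes> y))"
    using assms v(1,2) v(3)[of "x [^] n"] by (simp flip: m_assoc)
  finally have *: "?lhs = v [^] (n choose 2) \<otimes> v [^] n \<otimes> ?rhs"
    using assms v(1) by (simp add: m_assoc)
  have "v [^] (n choose 2) \<otimes> v [^] n = v [^] (Suc n choose 2)"
    using v by (simp add: nat_pow_mult numeral_2_eq_2 add.commute)
  with * show ?case by simp
qed (use assms in \<open>auto simp: numeral_2_eq_2\<close>)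

lemma subgroup_nat_pow_closed:
  assumes "subgroup K G" "x \<in> K"
  shows "x [^] (n::nat) \<in> K"
  by (induction n) (use assms in \<open>auto intro: subgroup.one_closed subgroup.m_closed\<close>)

text \<open>
  The conjugate of \<open>n\<close> by \<open>g\<close> is $[n,g]^{-1} n$. This is how all normality proofs below go: the
  subgroups in question contain the commutators of their elements with everything.
\<close>

lemma normalI_commutator:
  assumes "subgroup N G" "\<And>n g. n \<in> N \<Longrightarrow> g \<in> carrier G \<Longrightarrow> commutator G n g \<in> N"
  shows "N \<lhd> G"
  unfolding normal_inv_iff
proof (intro conjI ballI)
  fix g n assume g: "g \<in> carrier G" and n: "n \<in> N"
  have c: "n \<in> carrier G" using subgroup.mem_carrier[OF assms(1) n] .
  have "g \<otimes> n \<otimes> inv g = inv (commutator G n g) \<otimes> n"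
    using g c by (simp add: commutator_def m_assoc inv_mult_group)
  then show "g \<otimes> n \<otimes> inv g \<in> N"
    using assms n g by (simp add: subgroup.m_closed subgroup.m_inv_closed)
qed (use assms in auto)

end

lemma (in normal) commutator_mem:
  assumes "n \<in> H" "g \<in> carrier G"
  shows "commutator G n g \<in> H"
proof -
  have "commutator G n g = n \<otimes> (g \<otimes> inv n \<otimes> inv g)"
    using assms by (simp add: commutator_def m_assoc)
  then show ?thesis
    using assms inv_op_closed2 by auto
qed

lemma (in normal) quotient_group_hom: "group_hom G (G Mod H) ((#>) H)"
  by (simp add: group_hom_def group_hom_axioms_def factorgroup_is_group r_coset_hom_Mod)

lemma (in normal) quotient_eq_one_iff:
  "x \<in> carrier G \<Longrightarrow> H #> x = \<one>\<^bsub>G Mod H\<^esub> \<longleftrightarrow> x \<in> H"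
  by (metis coset_join1 coset_join2 one_FactGroup subset subgroup_axioms)

lemma (in group_hom) hom_commutator:
  "x \<in> carrier G \<Longrightarrow> y \<in> carrier G \<Longrightarrow> h (commutator G x y) = commutator H (h x) (h y)"
  by (simp add: commutator_def)

section \<open>Central elements of order dividing $p$ modulo a normal subgroup\<close>

text \<open>
  The preimage in \<open>G\<close> of the subgroup of all \<open>z\<close> in the centre of \<open>G / N\<close> with $z^p = 1$. Thus
  \<open>A \<subseteq> central_layer p G N\<close> says that \<open>A N / N\<close> is central in \<open>G / N\<close> and of exponent dividing \<open>p\<close>.
  The right-hand side makes sense for arbitrary \<open>N\<close>, so inclusions can be stated before \<open>N\<close> is
  known to be normal.
\<close>

definition central_layer :: "nat \<Rightarrow> ('a, 'm) monoid_scheme \<Rightarrow> 'a set \<Rightarrow> 'a set" where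
  "central_layer p G N =
     {x \<in> carrier G. x [^]\<^bsub>G\<^esub> p \<in> N \<and> (\<forall>g\<in>carrier G. commutator G x g \<in> N)}"

context normal
begin

lemma quotient_center_iff:
  assumes "x \<in> carrier G"
  shows "H #> x \<in> group_center (G Mod H) \<longleftrightarrow> (\<forall>g\<in>carrier G. commutator G x g \<in> H)"
proof -
  interpret h: group_hom G "G Mod H" "(#>) H" by (rule quotient_group_hom)
  have "commutator G x g \<in> H \<longleftrightarrow>
      (H #> x) \<otimes>\<^bsub>G Mod H\<^esub> (H #> g) = (H #> g) \<otimes>\<^bsub>G Mod H\<^esub> (H #> x)" if "g \<in> carrier G" for g
    using assms that quotient_eq_one_iff[of "commutator G x g"] h.hom_commutator[of x g]
      h.H.commutator_eq_one_iff[of "H #> x" "H #> g"] h.hom_closed by simp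
  then show ?thesis
    using assms h.hom_closed[of x] by (auto simp: group_center_def carrier_FactGroup)
qed

lemma subgroup_central_mod:
  "subgroup {x \<in> carrier G. \<forall>g\<in>carrier G. commutator G x g \<in> H} G"
proof -
  interpret h: group_hom G "G Mod H" "(#>) H" by (rule quotient_group_hom)
  note Z = h.H.subgroup_group_center
  have iff: "x \<in> {x \<in> carrier G. \<forall>g\<in>carrier G. commutator G x g \<in> H} \<longleftrightarrow>
      x \<in> carrier G \<and> H #> x \<in> group_center (G Mod H)" for x
    using quotient_center_iff[of x] by auto
  show ?thesis
  proof (rule subgroupI)
    show "{x \<in> carrier G. \<forall>g\<in>carrier G. commutator G x g \<in> H} \<noteq> {}"
      using iff[of \<one>] subgroup.one_closed[OF Z] h.hom_one by (metis empty_iff one_closed)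
  next
    fix a assume "a \<in> {x \<in> carrier G. \<forall>g\<in>carrier G. commutator G x g \<in> H}"
    then show "inv a \<in> {x \<in> carrier G. \<forall>g\<in>carrier G. commutator G x g \<in> H}"
      unfolding iff using subgroup.m_inv_closed[OF Z] by (metis h.hom_inv inv_closed)
  next
    fix a b assume "a \<in> {x \<in> carrier G. \<forall>g\<in>carrier G. commutator G x g \<in> H}"
      "b \<in> {x \<in> carrier G. \<forall>g\<in>carrier G. commutator G x g \<in> H}"
    then show "a \<otimes> b \<in> {x \<in> carrier G. \<forall>g\<in>carrier G. commutator G x g \<in> H}"
      unfolding iff using subgroup.m_closed[OF Z] by (metis h.hom_mult m_closed)
  qed auto
qed

lemma central_layer_iff:
  assumes "x \<in> carrier G"
  shows "x \<in> central_layer p G H \<longleftrightarrow>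
    H #> x \<in> group_center (G Mod H) \<and> (H #> x) [^]\<^bsub>G Mod H\<^esub> p = \<one>\<^bsub>G Mod H\<^esub>"
  using assms quotient_center_iff[OF assms] quotient_eq_one_iff[of "x [^] p"]
  by (auto simp: central_layer_def FactGroup_pow)

lemma subgroup_central_layer: "subgroup (central_layer p G H) G"
proof -
  interpret h: group_hom G "G Mod H" "(#>) H" by (rule quotient_group_hom)
  note Z = h.H.subgroup_group_center
  have sub: "central_layer p G H \<subseteq> carrier G"
    by (auto simp: central_layer_def)
  show ?thesis
  proof (rule subgroupI)
    show "central_layer p G H \<noteq> {}"
      using central_layer_iff[of \<one> p] subgroup.one_closed[OF Z] h.hom_one
      by (metis empty_iff h.H.nat_pow_one one_closed)
  next
    fix a assume a: "a \<in> central_layer p G H"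
    then have c: "a \<in> carrier G" using sub by auto
    show "inv a \<in> central_layer p G H"
      using a subgroup.m_inv_closed[OF Z] h.H.nat_pow_inv[OF h.hom_closed[OF c]] h.hom_inv[OF c]
      unfolding central_layer_iff[OF c] central_layer_iff[OF inv_closed[OF c]]
      by (metis h.H.inv_one)
  next
    fix a b assume ab: "a \<in> central_layer p G H" "b \<in> central_layer p G H"
    then have c: "a \<in> carrier G" "b \<in> carrier G" using sub by auto
    then have Zab: "H #> a \<in> group_center (G Mod H)" "H #> b \<in> group_center (G Mod H)"
      using ab central_layer_iff by blast+
    have "(H #> a) \<otimes>\<^bsub>G Mod H\<^esub> (H #> b) = (H #> b) \<otimes>\<^bsub>G Mod H\<^esub> (H #> a)"
      using group_centerD[OF Zab(1)] h.hom_closed c by blast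
    then have "((H #> a) \<otimes>\<^bsub>G Mod H\<^esub> (H #> b)) [^]\<^bsub>G Mod H\<^esub> p
        = (H #> a) [^]\<^bsub>G Mod H\<^esub> p \<otimes>\<^bsub>G Mod H\<^esub> (H #> b) [^]\<^bsub>G Mod H\<^esub> p"
      by (rule h.H.pow_mult_distrib) (use c h.hom_closed in blast)+
    then show "a \<otimes> b \<in> central_layer p G H"
      using ab c central_layer_iff[of a] central_layer_iff[of b] central_layer_iff[of "a \<otimes> b"]
        subgroup.m_closed[OF Z] h.hom_mult[of a b] by (metis h.H.one_closed h.H.r_one m_closed)
  qed (use sub in auto)
qed

lemma subset_central_layer: "H \<subseteq> central_layer p G H"
proof
  fix x assume x: "x \<in> H"
  then have "x \<in> carrier G" by simp
  then show "x \<in> central_layer p G H"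
    using x commutator_mem subgroup_nat_pow_closed[OF subgroup_axioms x] by (auto simp: central_layer_def)
qed

lemma normal_central_layer: "central_layer p G H \<lhd> G"
proof (rule normalI_commutator[OF subgroup_central_layer])
  fix n g assume "n \<in> central_layer p G H" "g \<in> carrier G"
  then have "commutator G n g \<in> H"
    by (simp add: central_layer_def)
  then show "commutator G n g \<in> central_layer p G H"
    using subset_central_layer by blast
qed

end

section \<open>Iterated commutators with the whole group\<close>

lemma (in group) commutator_subgroup_whole:
  assumes "N \<lhd> G"
  shows "commutator_subgroup G N (carrier G) \<lhd> G" "commutator_subgroup G N (carrier G) \<subseteq> N"
    and "\<And>n g. n \<in> N \<Longrightarrow> g \<in> carrier G \<Longrightarrow> commutator G n g \<in> commutator_subgroup G N (carrier G)"
proof -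
  interpret normal N G by fact
  let ?C = "commutator_subgroup G N (carrier G)"
  show mem: "commutator G n g \<in> ?C" if "n \<in> N" "g \<in> carrier G" for n g
    unfolding commutator_subgroup_eq using that by (blast intro: generate.incl)
  show sub: "?C \<subseteq> N"
    unfolding commutator_subgroup_eq
    by (rule generate_subgroup_incl) (use commutator_mem subgroup_axioms in auto)
  show "?C \<lhd> G"
  proof (rule normalI_commutator)
    show "subgroup ?C G"
      unfolding commutator_subgroup_eq by (rule generate_is_subgroup) auto
  qed (use sub mem in blast)
qed

lemma (in group) commutator_subgroup_mono:
  assumes "H \<subseteq> H'"
  shows "commutator_subgroup G H K \<subseteq> commutator_subgroup G H' K"
  unfolding commutator_subgroup_eq by (rule mono_generate) (use assms in blast)

lemma (in group) normal_iterated_commutator: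
  assumes "N \<lhd> G"
  shows "iterated_commutator G N c \<lhd> G \<and> iterated_commutator G N c \<subseteq> N"
proof (induction c)
  case (Suc c)
  then show ?case
    using commutator_subgroup_whole(1,2)[of "iterated_commutator G N c"] by auto
qed (use assms in simp)

lemma (in group) iterated_commutator_mono:
  "H \<subseteq> H' \<Longrightarrow> iterated_commutator G H c \<subseteq> iterated_commutator G H' c"
  by (induction c) (simp_all add: commutator_subgroup_mono)

text \<open>
  Central sections of exponent \<open>p\<close> survive taking commutators with the whole group. Since $[A,G]$
  lies in \<open>B\<close>, it is central modulo $[B,G]$. Hence $a \mapsto [a,f]$ is multiplicative on powers of
  \<open>a\<close> modulo $[B,G]$, and $[a,f]^p \equiv [a^p,f] \in [B,G]$ because $a^p \in B$.
\<close>

lemma (in group) commutator_subgroup_central_layer: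
  assumes B: "B \<lhd> G" and A: "A \<subseteq> central_layer p G B"
  shows "commutator_subgroup G A (carrier G) \<subseteq> central_layer p G (commutator_subgroup G B (carrier G))"
proof -
  let ?C = "commutator_subgroup G B (carrier G)"
  note C = commutator_subgroup_whole[OF B]
  interpret C: normal ?C G by (rule C(1))
  interpret q: group_hom G "G Mod ?C" "(#>) ?C" by (rule C.quotient_group_hom)
  let ?q = "(#>) ?C"
  have "commutator G a f \<in> central_layer p G ?C" if a: "a \<in> A" and f: "f \<in> carrier G" for a f
  proof -
    have ac: "a \<in> carrier G" and ap: "a [^] p \<in> B" and af: "commutator G a f \<in> B"
      using A a f by (auto simp: central_layer_def)
    have u: "?q (commutator G a f) \<in> group_center (G Mod ?C)"
      using C.quotient_center_iff[of "commutator G a f"] C(3)[OF af] ac f by simp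
    have "?q (a [^] p) \<in> group_center (G Mod ?C)"
      using C.quotient_center_iff[of "a [^] p"] C(3)[OF ap] ac by simp
    then have comm: "?q (a [^] p) \<otimes>\<^bsub>G Mod ?C\<^esub> ?q f = ?q f \<otimes>\<^bsub>G Mod ?C\<^esub> ?q (a [^] p)"
      by (rule group_centerD[OF _ q.hom_closed[OF f]])
    have "?q a \<otimes>\<^bsub>G Mod ?C\<^esub> ?q f
        = ?q (commutator G a f) \<otimes>\<^bsub>G Mod ?C\<^esub> (?q f \<otimes>\<^bsub>G Mod ?C\<^esub> ?q a)"
      using q.H.mult_eq_commutator_mult[OF q.hom_closed[OF ac] q.hom_closed[OF f]]
      unfolding q.hom_commutator[OF ac f] .
    from q.H.pow_mult_swap[OF q.hom_closed[OF f] q.hom_closed[OF ac] u this, of p]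
    have "?q f \<otimes>\<^bsub>G Mod ?C\<^esub> ?q (a [^] p)
        = ?q (commutator G a f) [^]\<^bsub>G Mod ?C\<^esub> p \<otimes>\<^bsub>G Mod ?C\<^esub> (?q f \<otimes>\<^bsub>G Mod ?C\<^esub> ?q (a [^] p))"
      unfolding q.hom_nat_pow[OF ac, symmetric] comm .
    then have "?q (commutator G a f) [^]\<^bsub>G Mod ?C\<^esub> p = \<one>\<^bsub>G Mod ?C\<^esub>"
      by (subst (asm) q.H.r_cancel_one') (use ac f q.hom_closed in \<open>simp_all del: mult_FactGroup one_FactGroup\<close>)
    with u show ?thesis
      unfolding C.central_layer_iff[OF commutator_closed[OF ac f]] by (rule conjI)
  qed
  then show ?thesis
    unfolding commutator_subgroup_eq[of _ A]
    by (intro generate_subgroup_incl C.subgroup_central_layer) blast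
qed

lemma (in group) iterated_commutator_central_layer:
  assumes "B \<lhd> G" "A \<subseteq> central_layer p G B"
  shows "iterated_commutator G A c \<subseteq> central_layer p G (iterated_commutator G B c)"
proof (induction c)
  case (Suc c)
  then show ?case
    using commutator_subgroup_central_layer normal_iterated_commutator[OF assms(1)] by simp
qed (use assms in simp)

text \<open>
  One $p$-th power per step of the chain: applying \<open>c\<close>-fold commutators to a chain whose sections
  are central of exponent \<open>p\<close> gives another such chain.
\<close>

lemma (in group) pow_mem_iterated_commutator:
  assumes "\<And>i. E i \<lhd> G" "\<And>i. E i \<subseteq> central_layer p G (E (Suc i))"
    and "x \<in> iterated_commutator G (E 0) c"
  shows "x [^] (p ^ i) \<in> iterated_commutator G (E i) c"
proof (induction i)
  case 0
  have "x \<in> carrier G"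
    using normal_iterated_commutator[OF assms(1)] assms(3) normal_imp_subgroup subgroup.mem_carrier
    by metis
  then show ?case
    using assms(3) by simp
next
  case (Suc i)
  have x: "x \<in> carrier G"
    using normal_iterated_commutator[OF assms(1)] assms(3) normal_imp_subgroup subgroup.mem_carrier
    by metis
  from Suc have "x [^] (p ^ i) \<in> central_layer p G (iterated_commutator G (E (Suc i)) c)"
    using iterated_commutator_central_layer[OF assms(1,2)] by blast
  then have "(x [^] (p ^ i)) [^] p \<in> iterated_commutator G (E (Suc i)) c"
    by (simp add: central_layer_def)
  then show ?case
    using x by (simp add: nat_pow_pow mult.commute)
qed

section \<open>The lower exponent-$p$ central series\<close>

primrec lower_p_series :: "nat \<Rightarrow> ('a, 'm) monoid_scheme \<Rightarrow> nat \<Rightarrow> 'a set" where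
  "lower_p_series p G 0 = carrier G"
| "lower_p_series p G (Suc i) = generate G
     ({commutator G x g | x g. x \<in> lower_p_series p G i \<and> g \<in> carrier G} \<union>
      {x [^]\<^bsub>G\<^esub> p | x. x \<in> lower_p_series p G i})"

declare lower_p_series.simps(2) [simp del]

context group
begin

lemma lower_p_series_subset_carrier: "lower_p_series p G i \<subseteq> carrier G"
proof (induction i)
  case (Suc i)
  show ?case
    unfolding lower_p_series.simps by (rule generate_incl) (use Suc in auto)
qed simp

lemma lower_p_series_layer:
  "lower_p_series p G i \<subseteq> central_layer p G (lower_p_series p G (Suc i))"
proof
  fix x assume x: "x \<in> lower_p_series p G i"
  then have "x [^] p \<in> lower_p_series p G (Suc i)"
    unfolding lower_p_series.simps by (intro generate.incl) blast
  moreover have "commutator G x g \<in> lower_p_series p G (Suc i)" if "g \<in> carrier G" for g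
    unfolding lower_p_series.simps using x that by (intro generate.incl) blast
  ultimately show "x \<in> central_layer p G (lower_p_series p G (Suc i))"
    using x lower_p_series_subset_carrier unfolding central_layer_def by blast
qed

text \<open>
  The next term of the series is the smallest subgroup modulo which the current one is central of
  exponent dividing \<open>p\<close>. This universal property and the inclusion \<open>lower_p_series_layer\<close> replace
  the generators in almost all later arguments.
\<close>

lemma lower_p_series_Suc_subset:
  assumes "subgroup K G" "lower_p_series p G i \<subseteq> central_layer p G K"
  shows "lower_p_series p G (Suc i) \<subseteq> K"
  unfolding lower_p_series.simps
  by (rule generate_subgroup_incl) (use assms in \<open>auto simp: central_layer_def\<close>)

lemma normal_lower_p_series_aux:
  "lower_p_series p G i \<lhd> G \<and> lower_p_series p G (Suc i) \<subseteq> lower_p_series p G i"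
proof (induction i)
  case 0
  show ?case
    using lower_p_series_subset_carrier[of p 1] normal_self by simp
next
  case (Suc i)
  let ?D = "lower_p_series p G (Suc i)"
  have "subgroup ?D G"
    unfolding lower_p_series.simps
    by (rule generate_is_subgroup) (use lower_p_series_subset_carrier[of p i] in auto)
  moreover have "commutator G n g \<in> ?D" if "n \<in> ?D" "g \<in> carrier G" for n g
    using that Suc lower_p_series_layer[of p i] unfolding central_layer_def by blast
  ultimately have D: "?D \<lhd> G"
    by (rule normalI_commutator)
  then show ?case
    using lower_p_series_Suc_subset[OF normal_imp_subgroup[OF D], of p "Suc i"]
      normal.subset_central_layer[OF D, of p] by blast
qed

lemma normal_lower_p_series: "lower_p_series p G i \<lhd> G"
  using normal_lower_p_series_aux by blast

lemma lower_p_series_antimono: "i \<le> j \<Longrightarrow> lower_p_series p G j \<subseteq> lower_p_series p G i"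
  by (rule lift_Suc_antimono_le[of "lower_p_series p G"]) (use normal_lower_p_series_aux in blast)

lemma lower_p_series_commutator:
  "x \<in> lower_p_series p G i \<Longrightarrow> g \<in> carrier G \<Longrightarrow> commutator G x g \<in> lower_p_series p G (Suc i)"
  using lower_p_series_layer[of p i] unfolding central_layer_def by blast

lemma lower_p_series_pow:
  "x \<in> lower_p_series p G i \<Longrightarrow> x [^] p \<in> lower_p_series p G (Suc i)"
  using lower_p_series_layer[of p i] unfolding central_layer_def by blast

lemma lower_p_series_pow_pow: "x \<in> carrier G \<Longrightarrow> x [^] (p ^ i) \<in> lower_p_series p G i"
proof (induction i)
  case (Suc i)
  then show ?case
    using lower_p_series_pow[of "x [^] (p ^ i)" p i] by (simp add: nat_pow_pow mult.commute)
qed simp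

end

section \<open>Finite $p$-groups\<close>

text \<open>
  The class equation: a conjugacy class has \<open>p\<close>-power size, and if the centre is trivial, then
  \<open>p\<close> divides the size of every class other than that of the identity. So $|G| \equiv 1$ modulo \<open>p\<close>,
  which is absurd.
\<close>

lemma (in group) p_group_center_nontrivial:
  assumes p: "prime p" and ord: "order G = p ^ n" and n: "n > 0"
  shows "\<exists>z \<in> group_center G. z \<noteq> \<one>"
proof (rule ccontr)
  assume trivial: "\<not> (\<exists>z \<in> group_center G. z \<noteq> \<one>)"
  let ?\<phi> = "\<lambda>g. \<lambda>h \<in> carrier G. g \<otimes> h \<otimes> inv g"
  interpret act: group_action G "carrier G" ?\<phi>
    by (rule action_by_conjugation)
  let ?O = "orbits G (carrier G) ?\<phi>"
  have fin: "finite (carrier G)"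
    using ord p order_gt_0_iff_finite by (simp add: prime_gt_0_nat)
  have one: "orbit G ?\<phi> \<one> = {\<one>}"
    using act.orbit_refl[of \<one>] by (auto simp: orbit_def)
  have "p dvd card (\<Union>(?O - {{\<one>}}))"
  proof (rule dvd_partition)
    show "finite (\<Union>(?O - {{\<one>}}))"
      by (rule finite_subset[OF _ fin]) (use act.orbits_coverture in blast)
    show "\<forall>c1\<in>?O - {{\<one>}}. \<forall>c2\<in>?O - {{\<one>}}. c1 \<noteq> c2 \<longrightarrow> c1 \<inter> c2 = {}"
      using act.disjoint_union by blast
    show "\<forall>c\<in>?O - {{\<one>}}. p dvd card c"
    proof
      fix c assume c: "c \<in> ?O - {{\<one>}}"
      then obtain x where x: "x \<in> carrier G" "c = orbit G ?\<phi> x"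
        by (auto simp: orbits_def)
      then have "x \<noteq> \<one>"
        using c one by auto
      have "card c dvd p ^ n"
        using act.orbit_stabilizer_theorem[OF x(1)] unfolding x(2) ord by (rule dvdI[OF sym])
      then obtain i where i: "card c = p ^ i"
        using divides_primepow_nat[OF p] by blast
      have "i \<noteq> 0"
      proof
        assume "i = 0"
        then have "card c = 1" using i by simp
        then have c1: "c = {x}"
          using act.orbit_refl[OF x(1)] x(2) by (auto simp: card_1_singleton_iff)
        \<comment> \<open>A class with one element consists of a central element.\<close>
        have "x \<otimes> g = g \<otimes> x" if g: "g \<in> carrier G" for g
        proof -
          have "g \<otimes> x \<otimes> inv g = x"
            using c1 x g by (auto simp: orbit_def)
          then show ?thesis
            using x(1) g inv_solve_right'[of x "g \<otimes> x" g] by simp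
        qed
        then show False
          using trivial x(1) \<open>x \<noteq> \<one>\<close> by (auto simp: group_center_def)
      qed
      then show "p dvd card c"
        using i by simp
    qed
  qed
  moreover have "\<Union>(?O - {{\<one>}}) = carrier G - {\<one>}"
  proof -
    have "{\<one>} \<in> ?O"
      using one by (auto simp: orbits_def)
    then have "c \<inter> {\<one>} = {}" if "c \<in> ?O - {{\<one>}}" for c
      using act.disjoint_union[of c "{\<one>}"] that by blast
    then show ?thesis
      using act.orbits_coverture by blast
  qed
  ultimately have "p dvd p ^ n - 1"
    using ord fin by (simp add: order_def)
  moreover have "p dvd p ^ n" "p ^ n > 0"
    using n p by (auto simp: prime_gt_0_nat)
  ultimately have "p dvd 1"
    by (metis One_nat_def Suc_leI dvd_diffD1)
  then show False
    using p by (simp add: prime_nat_iff)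
qed

lemma (in group) p_group_central_element_of_order_p:
  assumes p: "prime p" and ord: "order G = p ^ n" and n: "n > 0"
  shows "\<exists>z \<in> group_center G. z \<noteq> \<one> \<and> z [^] p = \<one>"
proof -
  obtain z where z: "z \<in> group_center G" "z \<noteq> \<one>"
    using p_group_center_nontrivial[OF assms] by blast
  then have zc: "z \<in> carrier G"
    by (simp add: group_center_def)
  define k where "k = (LEAST k. z [^] (p ^ k) = \<one>)"
  have k: "z [^] (p ^ k) = \<one>"
    unfolding k_def by (rule LeastI[of _ n]) (use pow_order_eq_1[OF zc] ord in simp)
  have "k \<noteq> 0"
    using k z zc by (metis nat_pow_eone power_0)
  then obtain j where j: "k = Suc j"
    using not0_implies_Suc by blast
  have "z [^] (p ^ j) \<noteq> \<one>"
    using not_less_Least[of j "\<lambda>k. z [^] (p ^ k) = \<one>"] j k_def by simp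
  moreover have "(z [^] (p ^ j)) [^] p = \<one>"
    using k j zc by (simp add: nat_pow_pow mult.commute)
  ultimately show ?thesis
    using group_center_pow[OF z(1)] by blast
qed

lemma (in group) central_layer_grows:
  assumes p: "prime p" and ord: "order G = p ^ n" and K: "K \<lhd> G" "K \<noteq> carrier G"
  shows "K \<subset> central_layer p G K"
proof -
  interpret normal K G by fact
  interpret q: group_hom G "G Mod K" "(#>) K" by (rule quotient_group_hom)
  have fin: "finite (carrier G)"
    using ord p order_gt_0_iff_finite by (simp add: prime_gt_0_nat)
  have "card K * order (G Mod K) = p ^ n"
    using lagrange[OF subgroup_axioms] ord by (simp add: order_def FactGroup_def mult.commute)
  then obtain m where m: "order (G Mod K) = p ^ m"
    using divides_primepow_nat[OF p] by (metis dvd_triv_right)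
  have "card K < card (carrier G)"
    using K(2) subset fin by (simp add: psubset_card_mono psubsetI)
  then have "order (G Mod K) \<noteq> 1"
    using \<open>card K * order (G Mod K) = p ^ n\<close> ord by (auto simp: order_def)
  then have "m > 0"
    using m by (cases m) auto
  then obtain z where z: "z \<in> group_center (G Mod K)" "z \<noteq> \<one>\<^bsub>G Mod K\<^esub>"
      "z [^]\<^bsub>G Mod K\<^esub> p = \<one>\<^bsub>G Mod K\<^esub>"
    using q.H.p_group_central_element_of_order_p[OF p m] by blast
  then obtain x where x: "x \<in> carrier G" "z = K #> x"
    by (auto simp: group_center_def carrier_FactGroup)
  then have "x \<in> central_layer p G K" "x \<notin> K"
    using z central_layer_iff quotient_eq_one_iff by blast+
  then show ?thesis
    using subset_central_layer by blast
qed

text \<open>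
  By induction from the top: a proper normal subgroup \<open>K\<close> is properly contained in its layer \<open>L\<close>,
  and a term of the series inside \<open>L\<close> is followed by one inside \<open>K\<close>. For \<open>K\<close> trivial this is the
  finiteness of the series.
\<close>

lemma (in group) lower_p_series_reaches:
  assumes p: "prime p" and ord: "order G = p ^ n" and "K \<lhd> G"
  shows "\<exists>i. lower_p_series p G i \<subseteq> K"
  using \<open>K \<lhd> G\<close>
proof (induction "card (carrier G - K)" arbitrary: K rule: less_induct)
  case less
  show ?case
  proof (cases "K = carrier G")
    case True
    then show ?thesis
      by (metis lower_p_series.simps(1) order_refl)
  next
    case False
    let ?L = "central_layer p G K"
    have fin: "finite (carrier G)"
      using ord p order_gt_0_iff_finite by (simp add: prime_gt_0_nat)
    have "K \<subset> ?L" "?L \<lhd> G"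
      using central_layer_grows[OF p ord] normal.normal_central_layer less False by blast+
    moreover have "?L \<subseteq> carrier G"
      by (auto simp: central_layer_def)
    ultimately have "card (carrier G - ?L) < card (carrier G - K)"
      using fin by (intro psubset_card_mono) auto
    then obtain i where "lower_p_series p G i \<subseteq> ?L"
      using less \<open>?L \<lhd> G\<close> by blast
    then have "lower_p_series p G (Suc i) \<subseteq> K"
      using lower_p_series_Suc_subset less normal_imp_subgroup by blast
    then show ?thesis by blast
  qed
qed

lemma (in normal) mem_of_same_coset:
  assumes "H #> a = H #> b" "a \<in> carrier G" "b \<in> K" "H \<subseteq> K" "subgroup K G"
  shows "a \<in> K"
proof -
  have "a \<in> H #> b"
    using assms(1,2) rcos_self[OF assms(2) subgroup_axioms] by simp
  then obtain h where "h \<in> H" "a = h \<otimes> b"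
    by (auto simp: r_coset_def)
  then show ?thesis
    using assms by (auto intro: subgroup.m_closed)
qed

text \<open>
  In the quotient, $g x^n = w^{n(n-1)/2}\, x^n u^n g$ with \<open>u\<close> and \<open>w\<close> as below, and the hypotheses
  remove the powers of \<open>w\<close> and \<open>u\<close>. The commutator \<open>u\<close> is taken with the inverse of \<open>x\<close> because
  the collection formula needs $g x = x u g$.
\<close>

lemma (in normal) commutator_pow_mem:
  fixes n :: nat
  assumes x: "x \<in> carrier G" and g: "g \<in> carrier G"
  defines "u \<equiv> commutator G (inv x) g"
  defines "w \<equiv> commutator G u x"
  assumes un: "u [^] n \<in> H" and wn: "w [^] (n choose 2) \<in> H"
    and w: "\<And>h. h \<in> carrier G \<Longrightarrow> commutator G w h \<in> H"
  shows "commutator G (x [^] n) g \<in> H"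
proof -
  interpret q: group_hom G "G Mod H" "(#>) H" by (rule quotient_group_hom)
  let ?Q = "G Mod H"
  have u: "u \<in> carrier G" and wc: "w \<in> carrier G"
    using x g by (simp_all add: u_def w_def)
  have c: "H #> x \<in> carrier ?Q" "H #> u \<in> carrier ?Q" "H #> g \<in> carrier ?Q"
    using x u g q.hom_closed by blast+
  have wZ: "H #> w \<in> group_center ?Q"
    using quotient_center_iff[OF wc] w by blast
  have "g \<otimes> x = x \<otimes> (u \<otimes> g)"
    using x g by (simp add: u_def commutator_def m_assoc flip: m_assoc[of x "inv x"])
  then have gx: "(H #> g) \<otimes>\<^bsub>?Q\<^esub> (H #> x) = (H #> x) \<otimes>\<^bsub>?Q\<^esub> ((H #> u) \<otimes>\<^bsub>?Q\<^esub> (H #> g))"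
    using q.hom_mult x u g by (metis m_closed)
  have "u \<otimes> x = w \<otimes> (x \<otimes> u)"
    using mult_eq_commutator_mult[OF u x] by (simp add: w_def)
  then have ux: "(H #> u) \<otimes>\<^bsub>?Q\<^esub> (H #> x) = (H #> w) \<otimes>\<^bsub>?Q\<^esub> ((H #> x) \<otimes>\<^bsub>?Q\<^esub> (H #> u))"
    using q.hom_mult x u wc by (metis m_closed)
  have "(H #> w) [^]\<^bsub>?Q\<^esub> (n choose 2) = \<one>\<^bsub>?Q\<^esub>" "(H #> u) [^]\<^bsub>?Q\<^esub> n = \<one>\<^bsub>?Q\<^esub>"
    using un wn quotient_eq_one_iff q.hom_nat_pow u wc by (metis nat_pow_closed)+
  with q.H.pow_conj_two_step[OF c wZ gx ux, of n]
  have "(H #> g) \<otimes>\<^bsub>?Q\<^esub> (H #> x) [^]\<^bsub>?Q\<^esub> n = (H #> x) [^]\<^bsub>?Q\<^esub> n \<otimes>\<^bsub>?Q\<^esub> (H #> g)"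
    using c by (simp del: mult_FactGroup one_FactGroup)
  then have "commutator ?Q (H #> x [^] n) (H #> g) = \<one>\<^bsub>?Q\<^esub>"
    using q.H.commutator_eq_one_iff q.hom_nat_pow[OF x] c by (metis q.H.nat_pow_closed)
  then show ?thesis
    using quotient_eq_one_iff q.hom_commutator x g by (metis nat_pow_closed commutator_closed)
qed

section \<open>Powerful $p$-groups\<close>

context group
begin

text \<open>
  For \<open>p = 2\<close> the definition gives fourth powers, which are squares of squares; the weaker statement
  with \<open>p\<close>-th powers is what both parities share.
\<close>

lemma powerful_derived_subset:
  assumes "powerful p G" "subgroup K G" "\<And>x. x \<in> carrier G \<Longrightarrow> x [^] p \<in> K"
  shows "derived G (carrier G) \<subseteq> K"
proof -
  have "mho p 1 G \<subseteq> K"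
    unfolding mho_def by (rule generate_subgroup_incl) (use assms in auto)
  moreover have "x [^] (p ^ 2) \<in> K" if "x \<in> carrier G" for x
    using assms(3)[of "x [^] p"] that by (simp add: nat_pow_pow power2_eq_square)
  then have "mho p 2 G \<subseteq> K"
    unfolding mho_def by (intro generate_subgroup_incl) (use assms in auto)
  ultimately show ?thesis
    using assms(1) by (auto simp: powerful_def)
qed

lemma commutator_mem_derived:
  "x \<in> carrier G \<Longrightarrow> y \<in> carrier G \<Longrightarrow> commutator G x y \<in> derived G (carrier G)"
  unfolding derived_eq_commutator_subgroup commutator_subgroup_eq by (rule generate.incl) blast

text \<open>
  For \<open>p = 2\<close>, commutators gain two steps in the series instead of one. The induction starts from
  the fourth powers in the definition of a powerful 2-group. For a square, $[x^2,g]$ lies in the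
  normal closure of $u^2$ and $[u,x]$, where $u = [x^{-1},g]$ is already two steps further down, so
  that both $u^2$ and $[u,x]$ are three steps down.
\<close>

lemma powerful_two_commutator_mem:
  assumes "powerful 2 G" "x \<in> lower_p_series 2 G i" "g \<in> carrier G"
  shows "commutator G x g \<in> lower_p_series 2 G (Suc (Suc i))"
  using assms(2,3)
proof (induction i arbitrary: x g)
  case 0
  have "mho 2 2 G \<subseteq> lower_p_series 2 G 2"
    unfolding mho_def
    by (rule generate_subgroup_incl)
      (use lower_p_series_pow_pow[of _ 2 2] normal_imp_subgroup[OF normal_lower_p_series] in auto)
  then show ?case
    using commutator_mem_derived[of x g] 0 assms(1) by (auto simp: powerful_def numeral_2_eq_2)
next
  case (Suc i)
  let ?N = "lower_p_series 2 G (Suc (Suc (Suc i)))"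
  interpret N: normal ?N G by (rule normal_lower_p_series)
  let ?C = "{d \<in> carrier G. \<forall>g\<in>carrier G. commutator G d g \<in> ?N}"
  have next_N: "commutator G d g \<in> ?N" "d [^] (2::nat) \<in> ?N"
    if "d \<in> lower_p_series 2 G (Suc (Suc i))" "g \<in> carrier G" for d g
    using lower_p_series_commutator[OF that] lower_p_series_pow[OF that(1)] by blast+
  have "lower_p_series 2 G (Suc i) \<subseteq> ?C"
    unfolding lower_p_series.simps(2)[of 2 G i]
  proof (rule generate_subgroup_incl[OF _ N.subgroup_central_mod], intro Un_least subsetI)
    fix d assume "d \<in> {commutator G x g |x g. x \<in> lower_p_series 2 G i \<and> g \<in> carrier G}"
    then obtain x h where x: "x \<in> lower_p_series 2 G i" "h \<in> carrier G" "d = commutator G x h"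
      by blast
    then show "d \<in> ?C"
      using Suc.IH[OF x(1,2)] next_N lower_p_series_subset_carrier[of 2 i] by auto
  next
    fix d assume "d \<in> {x [^] (2::nat) |x. x \<in> lower_p_series 2 G i}"
    then obtain x where x: "x \<in> lower_p_series 2 G i" and d: "d = x [^] (2::nat)"
      by blast
    have xc: "x \<in> carrier G"
      using x lower_p_series_subset_carrier by blast
    have "inv x \<in> lower_p_series 2 G i"
      using x subgroup.m_inv_closed[OF normal_imp_subgroup[OF normal_lower_p_series]] by blast
    then have u: "commutator G (inv x) g \<in> lower_p_series 2 G (Suc (Suc i))" if "g \<in> carrier G" for g
      using Suc.IH that by blast
    have "commutator G (x [^] (2::nat)) g \<in> ?N" if g: "g \<in> carrier G" for g
    proof (rule N.commutator_pow_mem[OF xc g])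
      show "commutator G (inv x) g [^] (2::nat) \<in> ?N"
        using next_N(2)[OF u[OF g] g] .
      have w: "commutator G (commutator G (inv x) g) x \<in> ?N"
        using next_N(1)[OF u[OF g] xc] .
      then show "commutator G (commutator G (inv x) g) x [^] ((2::nat) choose 2) \<in> ?N"
        by simp
      show "commutator G (commutator G (commutator G (inv x) g) x) h \<in> ?N" if "h \<in> carrier G" for h
        using N.commutator_mem[OF w that] .
    qed
    then show "d \<in> ?C"
      using d xc by simp
  qed
  then show ?case
    using Suc.prems by auto
qed

text \<open>
  This is the only form in which the parity of \<open>p\<close> enters later on. If \<open>p\<close> is odd, it divides
  $p(p-1)/2$, and the \<open>p\<close>-th power of the commutator is two steps down. If \<open>p = 2\<close>, the exponent is
  \<open>1\<close>, and the commutator itself is two steps down.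
\<close>

lemma powerful_commutator_pow_mem:
  assumes p: "prime p" and pw: "powerful p G" and x: "x \<in> lower_p_series p G i" and g: "g \<in> carrier G"
  shows "commutator G x g [^] (p choose 2) \<in> lower_p_series p G (Suc (Suc i))"
proof (cases "p = 2")
  case True
  have "commutator G x g \<in> lower_p_series p G (Suc (Suc i))"
    using powerful_two_commutator_mem pw x g True by blast
  then show ?thesis
    using True lower_p_series_subset_carrier by (metis binomial_n_n nat_pow_eone subsetD)
next
  case False
  interpret N: normal "lower_p_series p G (Suc (Suc i))" G by (rule normal_lower_p_series)
  have c: "commutator G x g \<in> carrier G"
    using x g lower_p_series_subset_carrier by (meson commutator_closed subsetD)
  have "2 < p"
    using p False prime_ge_2_nat[OF p] by linarith
  then have "p dvd (p choose 2)"
    using dvd_choose_prime[of 2 p] p by simp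
  then obtain m where m: "p choose 2 = p * m" ..
  have "commutator G x g [^] p \<in> lower_p_series p G (Suc (Suc i))"
    using lower_p_series_pow[OF lower_p_series_commutator[OF x g]] by simp
  then have "(commutator G x g [^] p) [^] k \<in> lower_p_series p G (Suc (Suc i))" for k :: nat
    by (rule subgroup_nat_pow_closed[OF N.subgroup_axioms])
  then show ?thesis
    using c by (simp add: m nat_pow_pow)
qed

text \<open>
  Modulo the term two steps down, the error in $(xy)^p = x^p y^p$ is the power $p(p-1)/2$ of the
  central commutator $[y,x]$.
\<close>

lemma powerful_pow_mult:
  assumes p: "prime p" and pw: "powerful p G"
    and x: "x \<in> lower_p_series p G i" and y: "y \<in> lower_p_series p G i"
  shows "lower_p_series p G (Suc (Suc i)) #> (x \<otimes> y) [^] p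
    = lower_p_series p G (Suc (Suc i)) #> (x [^] p \<otimes> y [^] p)"
proof -
  let ?N = "lower_p_series p G (Suc (Suc i))"
  interpret N: normal ?N G by (rule normal_lower_p_series)
  interpret q: group_hom G "G Mod ?N" "(#>) ?N" by (rule N.quotient_group_hom)
  let ?Q = "G Mod ?N"
  have c: "x \<in> carrier G" "y \<in> carrier G"
    using x y lower_p_series_subset_carrier by blast+
  let ?v = "commutator G y x"
  have v: "?v \<in> carrier G" "?v \<in> lower_p_series p G (Suc i)"
    using c by simp (rule lower_p_series_commutator[OF y c(1)])
  have vZ: "?N #> ?v \<in> group_center ?Q"
    using N.quotient_center_iff[OF v(1)] lower_p_series_commutator[OF v(2)] by simp
  have "y \<otimes> x = ?v \<otimes> (x \<otimes> y)"
    using mult_eq_commutator_mult c by blast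
  then have rel: "(?N #> y) \<otimes>\<^bsub>?Q\<^esub> (?N #> x) = (?N #> ?v) \<otimes>\<^bsub>?Q\<^esub> ((?N #> x) \<otimes>\<^bsub>?Q\<^esub> (?N #> y))"
    using q.hom_mult c v(1) by (metis m_closed)
  have "(?N #> ?v) [^]\<^bsub>?Q\<^esub> (p choose 2) = \<one>\<^bsub>?Q\<^esub>"
    using powerful_commutator_pow_mem[OF p pw y c(1)] N.quotient_eq_one_iff q.hom_nat_pow[OF v(1)]
    by (metis nat_pow_closed v(1))
  with q.H.pow_mult_class_two[OF q.hom_closed[OF c(1)] q.hom_closed[OF c(2)] vZ rel, of p]
  have "((?N #> x) \<otimes>\<^bsub>?Q\<^esub> (?N #> y)) [^]\<^bsub>?Q\<^esub> p
      = (?N #> x) [^]\<^bsub>?Q\<^esub> p \<otimes>\<^bsub>?Q\<^esub> (?N #> y) [^]\<^bsub>?Q\<^esub> p"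
    using c q.hom_closed by (simp del: mult_FactGroup one_FactGroup)
  then show ?thesis
    unfolding q.hom_nat_pow[OF c(1), symmetric] q.hom_nat_pow[OF c(2), symmetric]
      q.hom_mult[OF c, symmetric] q.hom_nat_pow[OF m_closed[OF c], symmetric]
      q.hom_mult[OF nat_pow_closed[OF c(1)] nat_pow_closed[OF c(2)], symmetric] .
qed

text \<open>
  Writing $D_i$ for the terms of the series: modulo $D_{i+2}$, the \<open>p\<close>-th powers of elements of $D_i$
  alone generate $D_{i+1}$, so the commutators can be dispensed with. For $i = 0$ this is the
  definition of a powerful group. For the step, $D_{i+1}$ is by induction generated modulo $D_{i+2}$ by
  powers $x^p$ with $x \in D_i$, and $[x^p,g]$ is, up to elements of $D_{i+3}$, the \<open>p\<close>-th power of
  $[x^{-1},g]^{-1} \in D_{i+1}$. Being generated modulo a subgroup is expressed by quantifying over the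
  subgroups \<open>K\<close> that contain it.
\<close>

lemma powerful_lower_p_series_Suc_subset:
  assumes p: "prime p" and pw: "powerful p G"
    and K: "subgroup K G" "lower_p_series p G (Suc (Suc i)) \<subseteq> K"
      "\<And>d. d \<in> lower_p_series p G i \<Longrightarrow> d [^] p \<in> K"
  shows "lower_p_series p G (Suc i) \<subseteq> K"
  using K
proof (induction i arbitrary: K)
  case 0
  have "commutator G x g \<in> K" if "x \<in> carrier G" "g \<in> carrier G" for x g
    using powerful_derived_subset[OF pw 0(1)] commutator_mem_derived[OF that] 0(3) by auto
  then show ?case
    using 0 by (intro lower_p_series_Suc_subset) (auto simp: central_layer_def)
next
  case (Suc i)
  note D = normal_lower_p_series[of p]
  \<comment> \<open>The intersection is normal, since commutators with elements of $D_{i+2}$ fall into $D_{i+3}$.\<close>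
  let ?K = "K \<inter> lower_p_series p G (Suc (Suc i))"
  have next_K: "commutator G d g \<in> ?K" if "d \<in> lower_p_series p G (Suc (Suc i))" "g \<in> carrier G" for d g
    using lower_p_series_commutator[OF that] Suc.prems(2) normal_lower_p_series_aux[of p "Suc (Suc i)"]
    by auto
  interpret K: normal ?K G
    by (rule normalI_commutator)
      (use subgroups_Inter_pair[OF Suc.prems(1) normal_imp_subgroup[OF D]] next_K in blast)+
  let ?C = "{d \<in> carrier G. \<forall>g\<in>carrier G. commutator G d g \<in> ?K}"
  have "lower_p_series p G (Suc i) \<subseteq> ?C"
  proof (rule Suc.IH[OF K.subgroup_central_mod])
    show "lower_p_series p G (Suc (Suc i)) \<subseteq> ?C"
      using next_K lower_p_series_subset_carrier[of p "Suc (Suc i)"] by auto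
  next
    fix x assume x: "x \<in> lower_p_series p G i"
    have xc: "x \<in> carrier G"
      using x lower_p_series_subset_carrier by blast
    have ix: "inv x \<in> lower_p_series p G i"
      using x subgroup.m_inv_closed[OF normal_imp_subgroup[OF D]] by blast
    have "commutator G (x [^] p) g \<in> ?K" if g: "g \<in> carrier G" for g
    proof (rule K.commutator_pow_mem[OF xc g])
      let ?u = "commutator G (inv x) g"
      have u: "?u \<in> lower_p_series p G (Suc i)"
        using lower_p_series_commutator[OF ix g] .
      then show "?u [^] p \<in> ?K"
        using Suc.prems(3) lower_p_series_pow by blast
      have w: "commutator G ?u x \<in> lower_p_series p G (Suc (Suc i))"
        using lower_p_series_commutator[OF u xc] .
      then show "commutator G (commutator G ?u x) h \<in> ?K" if "h \<in> carrier G" for h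
        using next_K that by blast
      have "commutator G ?u x [^] (p choose 2) \<in> K"
        using powerful_commutator_pow_mem[OF p pw u xc] Suc.prems(2) by blast
      moreover have "commutator G ?u x [^] k \<in> lower_p_series p G (Suc (Suc i))" for k :: nat
        by (rule subgroup_nat_pow_closed[OF normal_imp_subgroup[OF D] w])
      ultimately show "commutator G ?u x [^] (p choose 2) \<in> ?K"
        by blast
    qed
    then show "x [^] p \<in> ?C"
      using xc by simp
  qed
  then have "lower_p_series p G (Suc i) \<subseteq> central_layer p G ?K"
    using Suc.prems(3) lower_p_series_pow unfolding central_layer_def by blast
  then have "lower_p_series p G (Suc (Suc i)) \<subseteq> ?K"
    using lower_p_series_Suc_subset[OF K.subgroup_axioms] by blast
  then show ?case
    by blast
qed

text \<open>
  Modulo the next term, $D_i$ is generated by the $p^i$-th powers of elements of \<open>G\<close>: the \<open>p\<close>-th power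
  map from $D_i$ to $D_{i+1}$ modulo $D_{i+2}$ is a homomorphism that kills $D_{i+1}$, and its image
  generates by the previous lemma.
\<close>

lemma powerful_lower_p_series_subset:
  assumes p: "prime p" and pw: "powerful p G"
    and K: "subgroup K G" "lower_p_series p G (Suc i) \<subseteq> K"
      "\<And>x. x \<in> carrier G \<Longrightarrow> x [^] (p ^ i) \<in> K"
  shows "lower_p_series p G i \<subseteq> K"
  using K
proof (induction i arbitrary: K)
  case 0
  then show ?case
    by auto
next
  case (Suc i)
  let ?D = "lower_p_series p G i" and ?N = "lower_p_series p G (Suc (Suc i))"
  interpret N: normal ?N G by (rule normal_lower_p_series)
  interpret D: normal ?D G by (rule normal_lower_p_series)
  \<comment> \<open>It is a subgroup because taking \<open>p\<close>-th powers is multiplicative modulo \<open>?N\<close>.\<close>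
  let ?L = "{d \<in> ?D. d [^] p \<in> K}"
  have "subgroup ?L G"
  proof (rule subgroupI)
    show "?L \<noteq> {}"
      using D.one_closed subgroup.one_closed[OF Suc.prems(1)] by (metis (no_types, lifting) empty_iff mem_Collect_eq nat_pow_one)
  next
    fix a assume "a \<in> ?L"
    then show "inv a \<in> ?L"
      using subgroup.m_inv_closed[OF Suc.prems(1)] nat_pow_inv[of a p] D.mem_carrier by auto
  next
    fix a b assume ab: "a \<in> ?L" "b \<in> ?L"
    have "(a \<otimes> b) [^] p \<in> K"
    proof (rule N.mem_of_same_coset[OF powerful_pow_mult[OF p pw]])
      show "a [^] p \<otimes> b [^] p \<in> K"
        using ab subgroup.m_closed[OF Suc.prems(1)] by blast
    qed (use ab D.mem_carrier Suc.prems in auto)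
    then show "a \<otimes> b \<in> ?L"
      using ab D.m_closed by blast
  qed (use D.subset in auto)
  then have "?D \<subseteq> ?L"
  proof (rule Suc.IH)
    show "lower_p_series p G (Suc i) \<subseteq> ?L"
      using normal_lower_p_series_aux[of p i] lower_p_series_pow[of _ p "Suc i"] Suc.prems(2) by blast
    show "x [^] (p ^ i) \<in> ?L" if "x \<in> carrier G" for x
      using lower_p_series_pow_pow[OF that, of p i] Suc.prems(3)[OF that] that
      by (simp add: nat_pow_pow mult.commute)
  qed
  then show ?case
    using powerful_lower_p_series_Suc_subset[OF p pw Suc.prems(1), of i] Suc.prems(2) by auto
qed

text \<open>
  If all $p^e$-th powers are trivial, the previous lemma gives $D_e = D_{e+1}$. Then the series is
  constant from there on, and in a finite \<open>p\<close>-group it reaches the trivial subgroup.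
\<close>

theorem powerful_lower_p_series_trivial:
  assumes p: "prime p" and pw: "powerful p G" and ord: "order G = p ^ n"
    and exp: "\<And>x. x \<in> carrier G \<Longrightarrow> x [^] (p ^ e) = \<one>"
  shows "lower_p_series p G e = {\<one>}"
proof -
  note D = normal_imp_subgroup[OF normal_lower_p_series[of p]]
  have stable: "lower_p_series p G e \<subseteq> lower_p_series p G (Suc e)"
    by (rule powerful_lower_p_series_subset[OF p pw D order_refl])
      (use exp subgroup.one_closed[OF D] in simp)
  have "lower_p_series p G e \<subseteq> lower_p_series p G (e + k)" for k
  proof (induction k)
    case (Suc k)
    have "lower_p_series p G e \<subseteq> central_layer p G (lower_p_series p G (Suc (e + k)))"
      using Suc lower_p_series_layer[of p "e + k"] by blast
    then show ?case
      using stable lower_p_series_Suc_subset[OF D[of "Suc (e + k)"], of p e] by auto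
  qed simp
  moreover obtain k where "lower_p_series p G k \<subseteq> {\<one>}"
    using lower_p_series_reaches[OF p ord one_is_normal] by blast
  ultimately show ?thesis
    using lower_p_series_antimono[of k "e + k" p] subgroup.one_closed[OF D[of e]] by auto
qed

end

section \<open>Exponents\<close>

text \<open>
  The least annihilating exponent divides $p^e$ and so is a power of \<open>p\<close>; hence the definite
  description in \<open>log_exponent\<close> denotes its logarithm.
\<close>

lemma (in group)
  assumes p: "prime p" and exp: "\<And>x. x \<in> carrier G \<Longrightarrow> x [^] (p ^ e) = \<one>"
  shows log_exponent_le: "log_exponent p G \<le> e"
    and pow_log_exponent: "\<And>x. x \<in> carrier G \<Longrightarrow> x [^] (p ^ log_exponent p G) = \<one>"
proof -
  define m where "m = group_exponent G"
  let ?P = "\<lambda>n::nat. 0 < n \<and> (\<forall>x\<in>carrier G. x [^] n = \<one>)"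
  have m_Least: "m = (LEAST n. ?P n)"
    by (simp add: m_def group_exponent_def)
  have "?P m"
    unfolding m_Least by (rule LeastI[of _ "p ^ e"]) (use exp p prime_gt_0_nat in auto)
  then have m: "0 < m" "\<And>x. x \<in> carrier G \<Longrightarrow> x [^] m = \<one>"
    by auto
  have rem: "x [^] (p ^ e mod m) = \<one>" if x: "x \<in> carrier G" for x
  proof -
    have "x [^] (p ^ e) = (x [^] m) [^] (p ^ e div m) \<otimes> x [^] (p ^ e mod m)"
      using x by (simp add: nat_pow_pow nat_pow_mult)
    then show ?thesis
      using exp x m by simp
  qed
  have "\<not> ?P (p ^ e mod m)"
    by (rule not_less_Least[of "p ^ e mod m" ?P, folded m_Least, OF mod_less_divisor[OF m(1)]])
  then have "p ^ e mod m = 0"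
    using rem by (metis not_gr_zero)
  then have "m dvd p ^ e"
    by (rule mod_0_imp_dvd)
  then obtain k where k: "k \<le> e" "m = p ^ k"
    using divides_primepow_nat[OF p] by blast
  have "log_exponent p G = k"
    unfolding log_exponent_def m_def[symmetric] k(2)
    by (rule the_equality) (use p prime_gt_1_nat power_inject_exp in auto)
  then show "log_exponent p G \<le> e"
    "\<And>x. x \<in> carrier G \<Longrightarrow> x [^] (p ^ log_exponent p G) = \<one>"
    using k m m_def by auto
qed

section \<open>Exponent of the multiplier\<close>

lemma (in group_hom) central_layer_vimage:
  assumes "D \<subseteq> central_layer p H D'"
  shows "{x \<in> carrier G. h x \<in> D} \<subseteq> central_layer p G {x \<in> carrier G. h x \<in> D'}"
proof
  fix x assume "x \<in> {x \<in> carrier G. h x \<in> D}"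
  then have x: "x \<in> carrier G" "h x \<in> central_layer p H D'"
    using assms by blast+
  then show "x \<in> central_layer p G {x \<in> carrier G. h x \<in> D'}"
    by (simp add: central_layer_def hom_commutator hom_nat_pow)
qed

lemma (in group_hom) normal_vimage:
  assumes "D \<lhd> H"
  shows "{x \<in> carrier G. h x \<in> D} \<lhd> G"
proof -
  interpret D: normal D H by fact
  have "subgroup {x \<in> carrier G. h x \<in> D} G"
    by (rule G.subgroupI) auto
  then show ?thesis
    by (rule G.normalI_commutator) (use D.commutator_mem hom_commutator in auto)
qed

theorem theorem3p3:
  fixes p c :: nat
    and G :: "('a, 'm) monoid_scheme"
    and F :: "('b, 'n) monoid_scheme"
    and R :: "'b set"
  assumes "prime p"
    and "c \<ge> 1"
    and "finite_p_group p G"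
    and "powerful p G"
    and "free_group F"
    and "R \<lhd> F"
    and "F Mod R \<cong> G"
  shows "log_exponent p (nilpotent_multiplier c F R) \<le> log_exponent p G"
proof -
  interpret G: group G
    using assms(3) by (simp add: finite_p_group_def)
  interpret R: normal R F by fact
  interpret q: group_hom F "F Mod R" "(#>\<^bsub>F\<^esub>) R" by (rule R.quotient_group_hom)
  obtain n where ord: "order G = p ^ n"
    using assms(3) by (auto simp: finite_p_group_def)
  obtain \<psi> where \<psi>: "\<psi> \<in> iso (F Mod R) G"
    using assms(7) by (auto simp: is_iso_def)
  let ?e = "log_exponent p G"
  have "x [^]\<^bsub>G\<^esub> (p ^ n) = \<one>\<^bsub>G\<^esub>" if "x \<in> carrier G" for x
    using G.pow_order_eq_1[OF that] ord by simp
  then have "x [^]\<^bsub>G\<^esub> (p ^ ?e) = \<one>\<^bsub>G\<^esub>" if "x \<in> carrier G" for x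
    using G.pow_log_exponent[OF assms(1) _ that] by blast
  then have trivial: "lower_p_series p G ?e = {\<one>\<^bsub>G\<^esub>}"
    by (rule G.powerful_lower_p_series_trivial[OF assms(1,4) ord])
  let ?h = "\<lambda>x. \<psi> (R #>\<^bsub>F\<^esub> x)"
  have "?h \<in> hom F G"
    using hom_compose[OF R.r_coset_hom_Mod, of \<psi> G] \<psi> by (simp add: iso_def comp_def)
  then interpret h: group_hom F G ?h
    by (simp add: group_hom_def group_hom_axioms_def)
  \<comment> \<open>The preimages in \<open>F\<close> of the series of \<open>G\<close> lead from \<open>F\<close> down to \<open>R\<close> in \<open>?e\<close> steps.\<close>
  define E where "E i = {x \<in> carrier F. ?h x \<in> lower_p_series p G i}" for i
  have E_normal: "E i \<lhd> F" for i
    unfolding E_def by (rule h.normal_vimage[OF G.normal_lower_p_series])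
  have E_layer: "E i \<subseteq> central_layer p F (E (Suc i))" for i
    unfolding E_def by (rule h.central_layer_vimage[OF G.lower_p_series_layer])
  have E_0: "E 0 = carrier F"
    by (auto simp: E_def)
  have "?h x = \<one>\<^bsub>G\<^esub> \<longleftrightarrow> x \<in> R" if x: "x \<in> carrier F" for x
  proof -
    have "\<psi> (\<one>\<^bsub>F Mod R\<^esub>) = \<one>\<^bsub>G\<^esub>"
      using \<psi> hom_one[OF _ q.H.is_group G.is_group] by (auto simp: iso_def)
    moreover have "inj_on \<psi> (carrier (F Mod R))"
      using \<psi> by (auto simp: iso_def bij_betw_def)
    ultimately have "?h x = \<one>\<^bsub>G\<^esub> \<longleftrightarrow> R #>\<^bsub>F\<^esub> x = \<one>\<^bsub>F Mod R\<^esub>"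
      using q.hom_closed[OF x] q.H.one_closed by (metis inj_on_eq_iff)
    then show ?thesis
      using R.quotient_eq_one_iff[OF x] by simp
  qed
  then have E_e: "E ?e = R"
    using R.subset by (auto simp: E_def trivial)
  let ?S = "R \<inter> lower_central F (c + 1)" and ?N = "iterated_commutator F R c"
  have pow: "x [^]\<^bsub>F\<^esub> (p ^ ?e) \<in> ?N" if "x \<in> ?S" for x
    using R.pow_mem_iterated_commutator[where E = E, OF E_normal E_layer, of x c ?e] that E_0 E_e
    by (simp add: lower_central_def)
  have "lower_central F (c + 1) \<lhd> F"
    using R.normal_iterated_commutator[OF R.normal_self] by (simp add: lower_central_def)
  then have S: "subgroup ?S F"
    by (intro R.subgroups_Inter_pair R.subgroup_axioms normal_imp_subgroup)
  have N: "?N \<lhd> F" "?N \<subseteq> ?S"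
    using R.normal_iterated_commutator[OF \<open>R \<lhd> F\<close>, of c]
      R.iterated_commutator_mono[OF R.subset, of c] by (auto simp: lower_central_def)
  let ?FS = "F\<lparr>carrier := ?S\<rparr>"
  \<comment> \<open>The quotient must be a group for its exponent to be a power of \<open>p\<close>.\<close>
  interpret M: normal ?N ?FS
    by (rule R.normal_restrict_supergroup[OF S N])
  interpret qM: group_hom ?FS "?FS Mod ?N" "(#>\<^bsub>?FS\<^esub>) ?N" by (rule M.quotient_group_hom)
  have "y [^]\<^bsub>?FS Mod ?N\<^esub> (p ^ ?e) = \<one>\<^bsub>?FS Mod ?N\<^esub>" if y: "y \<in> carrier (?FS Mod ?N)" for y
  proof -
    obtain x where x: "x \<in> ?S" "y = ?N #>\<^bsub>?FS\<^esub> x"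
      using y by (auto simp: carrier_FactGroup)
    have "x [^]\<^bsub>?FS\<^esub> (p ^ ?e) \<in> ?N"
      using pow[OF x(1)] R.nat_pow_consistent by metis
    then show ?thesis
      using qM.hom_nat_pow[of x "p ^ ?e"] M.quotient_eq_one_iff[of "x [^]\<^bsub>?FS\<^esub> (p ^ ?e)"]
        x M.nat_pow_closed[of x] by simp
  qed
  then show ?thesis
    unfolding nilpotent_multiplier_def by (rule qM.H.log_exponent_le[OF assms(1)])
qed

end
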